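(* Every action $G\curvearrowright X$ of a countably infinite group $G$ on a compact metrizable group $X$ (not necessarily abelian) by continuous automorphisms has the topological Markov property.
   Context: Fix a compatible metric $d$ on $X$ (the property does not depend on its choice). For $K\subset G$ and $x,y\in X$ write $d_K(x,y)=\sup_{g\in K}d(gx,gy)$. Memory set: for $\varepsilon,\delta>0$ and finite $A\subset B\subset G$, $B$ is an $(\varepsilon,\delta)$-memory set for $A$ if for every $x,y\in X$ with $d_{B\setminus A}(x,y)\le\delta$ there is $z\in X$ with $d_B(x,z)\le\varepsilon$ and $d_{G\setminus A}(y,z)\le\varepsilon$. Topological Markov property (TMP): for every $\varepsilon>0$ there is $\delta>0$ such that every finite $A\subset G$ admits an $(\varepsilon,\delta)$-memory set. *)

theory Defs
  imports "HOL-Analysis.Analysis" "HOL-Algebra.Bij"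
begin

locale topological_group = group X for X (structure) and T :: "'x topology" +
  assumes topspace_eq: "topspace T = carrier X"
    and continuous_mult: "continuous_map (prod_topology T T) T (\<lambda>(x, y). x \<otimes> y)"
    and continuous_inv: "continuous_map T T (\<lambda>x. inv x)"

locale compact_metrizable_group = topological_group +
  assumes compact: "compact_space T"
    and metrizable: "metrizable_space T"

text \<open>
  An action is a homomorphism into \<^const>\<open>AutoGroup\<close>, so each \<open>\<phi> g\<close> is
  extensional on \<open>carrier X\<close>. The inverse of \<open>\<phi> g\<close> is the map of the inverse of
  \<open>g\<close>, hence continuous as well: every \<open>\<phi> g\<close> is a topological automorphism.
\<close>

locale continuous_automorphism_action =
  group_hom G "AutoGroup X" \<phi> + topological_group X T
  for G :: "('g, 'm) monoid_scheme" and X :: "('x, 'n) monoid_scheme"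
    and T :: "'x topology" and \<phi> :: "'g \<Rightarrow> 'x \<Rightarrow> 'x" +
  assumes continuous_act: "g \<in> carrier G \<Longrightarrow> continuous_map T T (\<phi> g)"

definition compatible_metric :: "'x topology \<Rightarrow> ('x \<Rightarrow> 'x \<Rightarrow> real) \<Rightarrow> bool" where
  "compatible_metric T d \<longleftrightarrow>
     Metric_space (topspace T) d \<and> Metric_space.mtopology (topspace T) d = T"

text \<open>
  The supremum \<open>d\<^sub>K(x, y)\<close> is taken in \<open>[0, \<infinity>]\<close>, so that it is \<open>0\<close> for \<open>K = {}\<close>
  and is meaningful for infinite \<open>K\<close>.
\<close>

definition orbit_dist ::
  "('x \<Rightarrow> 'x \<Rightarrow> real) \<Rightarrow> ('g \<Rightarrow> 'x \<Rightarrow> 'x) \<Rightarrow> 'g set \<Rightarrow> 'x \<Rightarrow> 'x \<Rightarrow> ennreal" where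
  "orbit_dist d \<phi> K x y = (SUP g\<in>K. ennreal (d (\<phi> g x) (\<phi> g y)))"

text \<open>In the next two definitions \<open>G\<close> and \<open>S\<close> are the underlying sets of the acting
  group and of the space.\<close>

definition memory_set ::
  "'g set \<Rightarrow> 'x set \<Rightarrow> ('x \<Rightarrow> 'x \<Rightarrow> real) \<Rightarrow> ('g \<Rightarrow> 'x \<Rightarrow> 'x) \<Rightarrow>
   real \<Rightarrow> real \<Rightarrow> 'g set \<Rightarrow> 'g set \<Rightarrow> bool" where
  "memory_set G S d \<phi> \<epsilon> \<delta> A B \<longleftrightarrow>
     finite B \<and> A \<subseteq> B \<and> B \<subseteq> G \<and>
     (\<forall>x\<in>S. \<forall>y\<in>S. orbit_dist d \<phi> (B - A) x y \<le> ennreal \<delta> \<longrightarrow>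
        (\<exists>z\<in>S. orbit_dist d \<phi> B x z \<le> ennreal \<epsilon> \<and>
               orbit_dist d \<phi> (G - A) y z \<le> ennreal \<epsilon>))"

definition topological_markov_property ::
  "'g set \<Rightarrow> 'x set \<Rightarrow> ('x \<Rightarrow> 'x \<Rightarrow> real) \<Rightarrow> ('g \<Rightarrow> 'x \<Rightarrow> 'x) \<Rightarrow> bool" where
  "topological_markov_property G S d \<phi> \<longleftrightarrow>
     (\<forall>\<epsilon>>0. \<exists>\<delta>>0. \<forall>A. finite A \<and> A \<subseteq> G \<longrightarrow> (\<exists>B. memory_set G S d \<phi> \<epsilon> \<delta> A B))"

end

(* If g w is near the identity for all g in a sufficiently large finite set disjoint from A, then
   by compactness w is close, along A, to some w' such that g w' is near the identity for every g
   outside A. Applied to w = x^-1 y, this makes z = y w'^-1 the required point, since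
   x = y w^-1 and y = y 1^-1, and (a, u) |-> a u^-1 is uniformly continuous. The bound on w
   depends only on epsilon, while the finite set may depend on A. *)
theory Submission
  imports Defs
begin

text \<open>Heine-Cantor on the compact square of the space. The modulus \<open>\<delta>\<close>
  does not depend on the first argument, which is what is needed later: there \<open>a\<close> is
  \<open>\<phi> g x\<close> or \<open>\<phi> g y\<close>, and \<open>g\<close> ranges over an
  infinite group.\<close>

lemma compact_imp_uniformly_equicontinuous:
  assumes "compact_space T" and "compatible_metric T d"
    and "continuous_map (prod_topology T T) T (\<lambda>(x, y). f x y)" and "\<epsilon> > 0"
  obtains \<delta> where "\<delta> > 0"
    and "\<And>a b c. \<lbrakk>a \<in> topspace T; b \<in> topspace T; c \<in> topspace T; d b c < \<delta>\<rbrakk>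
      \<Longrightarrow> d (f a b) (f a c) < \<epsilon>"
proof -
  interpret Metric_space "topspace T" d
    using assms(2) by (simp add: compatible_metric_def)
  define m where "m = metric (topspace T, d)"
  have m [simp]: "mspace m = topspace T" "mdist m = d" "mtopology_of m = T"
    using assms(2) by (simp_all add: m_def mtopology_of_def compatible_metric_def)
  have "uniformly_continuous_map (prod_metric m m) m (\<lambda>(x, y). f x y)"
    using assms by (intro continuous_imp_uniformly_continuous_map)
      (simp add: compact_space_prod_topology)
  then obtain \<delta> where "\<delta> > 0" and \<delta>:
    "\<forall>p\<in>topspace T \<times> topspace T. \<forall>q\<in>topspace T \<times> topspace T.
       prod_dist d d q p < \<delta> \<longrightarrow> d (case q of (x, y) \<Rightarrow> f x y) (case p of (x, y) \<Rightarrow> f x y) < \<epsilon>"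
    using \<open>\<epsilon> > 0\<close> by (auto simp: uniformly_continuous_map_def)
  show thesis
  proof (rule that [OF \<open>\<delta> > 0\<close>])
    fix a b c
    assume "a \<in> topspace T" "b \<in> topspace T" "c \<in> topspace T" "d b c < \<delta>"
    then show "d (f a b) (f a c) < \<epsilon>"
      \<comment> \<open>The two pairs share the first coordinate, so \<open>prod_dist\<close>
        collapses to \<open>d b c\<close>.\<close>
      using \<delta> [rule_format, of "(a, c)" "(a, b)"] by (simp add: prod_dist_def)
  qed
qed

text \<open>The complements of the \<open>C i\<close> form an open cover of the compact set
  \<open>topspace T - V\<close>, and a finite subcover gives \<open>F\<close>. Intersecting with
  \<open>topspace T\<close> keeps the empty index set meaningful, since an intersection over it is
  the whole type.\<close>

lemma compact_space_finite_Inter_subset: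
  assumes "compact_space T" and "\<And>i. i \<in> I \<Longrightarrow> closedin T (C i)" and "openin T V"
    and "topspace T \<inter> (\<Inter>i\<in>I. C i) \<subseteq> V"
  obtains F where "finite F" "F \<subseteq> I" "topspace T \<inter> (\<Inter>i\<in>F. C i) \<subseteq> V"
proof -
  have "compactin T (topspace T - V)"
    using assms(1,3) by (intro closedin_compact_space) auto
  then obtain \<F> where "finite \<F>" "\<F> \<subseteq> (\<lambda>i. topspace T - C i) ` I" "topspace T - V \<subseteq> \<Union>\<F>"
    using assms by (elim compactinD [where \<U> = "(\<lambda>i. topspace T - C i) ` I", THEN exE]) auto
  then obtain F where "finite F" "F \<subseteq> I" "topspace T - V \<subseteq> (\<Union>i\<in>F. topspace T - C i)"
    by (metis finite_subset_image)
  moreover from this(3) have "topspace T \<inter> (\<Inter>i\<in>F. C i) \<subseteq> V"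
    by auto
  ultimately show thesis
    by (intro that)
qed

text \<open>The points that are close, along all \<open>f a\<close>, to some point of the full
  intersection form an open set containing that intersection. By compactness some finite
  subintersection already lies in this open set.\<close>

lemma compact_space_finite_Inter_approx:
  assumes "compact_space T" and "compatible_metric T d"
    and "\<And>i. i \<in> I \<Longrightarrow> closedin T (C i)" and "finite A"
    and cont: "\<And>a. a \<in> A \<Longrightarrow> continuous_map T T (f a)" and "\<eta> > 0"
  shows "\<exists>F. finite F \<and> F \<subseteq> I \<and> (\<forall>w\<in>topspace T. (\<forall>i\<in>F. w \<in> C i) \<longrightarrow>
    (\<exists>w'\<in>topspace T. (\<forall>i\<in>I. w' \<in> C i) \<and> (\<forall>a\<in>A. d (f a w) (f a w') < \<eta>)))"
proof -
  interpret Metric_space "topspace T" d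
    using assms(2) by (simp add: compatible_metric_def)
  have T: "mtopology = T"
    using assms(2) by (simp add: compatible_metric_def)
  define N where
    "N v = topspace T \<inter> (\<Inter>a\<in>A. {w \<in> topspace T. f a w \<in> mball (f a v) \<eta>})" for v
  define V where "V = (\<Union>v\<in>topspace T \<inter> (\<Inter>i\<in>I. C i). N v)"
  have "openin T (N v)" for v
  \<comment> \<open>Finiteness of \<open>A\<close> makes this intersection of open preimages open.
    The empty intersection is treated separately: there \<open>N v\<close> is the whole
    space.\<close>
  proof (cases "A = {}")
    case False
    have "openin T {w \<in> topspace T. f a w \<in> mball (f a v) \<eta>}" if "a \<in> A" for a
      using cont [OF that] openin_mball T by (metis openin_continuous_map_preimage)
    then show ?thesis
      unfolding N_def using False \<open>finite A\<close> by (intro openin_Int openin_INT2) auto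
  qed (simp add: N_def)
  then have "openin T V"
    by (auto simp: V_def)
  moreover have "v \<in> N v" if "v \<in> topspace T" for v
    using that cont \<open>\<eta> > 0\<close> continuous_map_image_subset_topspace
    by (fastforce simp: N_def image_subset_iff)
  then have "topspace T \<inter> (\<Inter>i\<in>I. C i) \<subseteq> V"
    by (force simp: V_def)
  ultimately obtain F where "finite F" "F \<subseteq> I" and F: "topspace T \<inter> (\<Inter>i\<in>F. C i) \<subseteq> V"
    using compact_space_finite_Inter_subset assms by metis
  show ?thesis
  proof (intro exI conjI ballI impI)
    fix w
    assume "w \<in> topspace T" "\<forall>i\<in>F. w \<in> C i"
    then have "w \<in> V"
      using F by blast
    then show "\<exists>w'\<in>topspace T. (\<forall>i\<in>I. w' \<in> C i) \<and> (\<forall>a\<in>A. d (f a w) (f a w') < \<eta>)"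
      by (auto simp: V_def N_def commute)
  qed fact+
qed

text \<open>Replaces the extended supremum by pointwise real inequalities. A negative
  \<open>c\<close> would break this, because \<open>ennreal\<close> sends it to 0.\<close>

lemma orbit_dist_le_iff:
  assumes "c \<ge> 0"
  shows "orbit_dist d \<phi> K x y \<le> ennreal c \<longleftrightarrow> (\<forall>g\<in>K. d (\<phi> g x) (\<phi> g y) \<le> c)"
  using assms by (simp add: orbit_dist_def SUP_le_iff)

lemma (in continuous_automorphism_action) act_hom:
  assumes "g \<in> carrier G"
  shows "group_hom X X (\<phi> g)"
  using hom_closed [OF assms]
  by (simp add: AutoGroup_def auto_def group_hom_def group_hom_axioms_def)

theorem proposition4p1:
  fixes G :: "('g, 'm) monoid_scheme" and X :: "('x, 'n) monoid_scheme"
    and T :: "'x topology" and \<phi> :: "'g \<Rightarrow> 'x \<Rightarrow> 'x" and d :: "'x \<Rightarrow> 'x \<Rightarrow> real"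
  assumes "group G" and "countable (carrier G)" and "infinite (carrier G)"
    and "compact_metrizable_group X T"
    and "continuous_automorphism_action G X T \<phi>"
    and "compatible_metric T d"
  shows "topological_markov_property (carrier G) (carrier X) d \<phi>"
  unfolding topological_markov_property_def
proof (intro allI impI)
  fix \<epsilon> :: real
  assume "\<epsilon> > 0"
  interpret X: compact_metrizable_group X T by fact
  interpret act: continuous_automorphism_action G X T \<phi> by fact
  interpret M: Metric_space "topspace T" d
    using assms(6) by (simp add: compatible_metric_def)
  have T: "M.mtopology = T"
    using assms(6) by (simp add: compatible_metric_def)
  note [simp] = X.topspace_eq
  have hom: "group_hom X X (\<phi> g)" if "g \<in> carrier G" for g
    using act.act_hom [OF that] .
  have cl [simp]: "\<phi> g x \<in> carrier X" if "g \<in> carrier G" "x \<in> carrier X" for g x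
    using hom [OF that(1)] that(2) by (rule group_hom.hom_closed)
  have mult [simp]: "\<phi> g (x \<otimes>\<^bsub>X\<^esub> y) = \<phi> g x \<otimes>\<^bsub>X\<^esub> \<phi> g y"
    if "g \<in> carrier G" "x \<in> carrier X" "y \<in> carrier X" for g x y
    using group_hom.hom_mult [OF hom] that by metis
  have inv [simp]: "\<phi> g (inv\<^bsub>X\<^esub> x) = inv\<^bsub>X\<^esub> (\<phi> g x)" if "g \<in> carrier G" "x \<in> carrier X" for g x
    using group_hom.hom_inv [OF hom] that by metis
  have "continuous_map (prod_topology T T) T (\<lambda>p. fst p \<otimes>\<^bsub>X\<^esub> inv\<^bsub>X\<^esub> (snd p))"
    "continuous_map (prod_topology T T) T (\<lambda>p. inv\<^bsub>X\<^esub> (fst p) \<otimes>\<^bsub>X\<^esub> snd p)"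
  proof -
    have *: "continuous_map (prod_topology T T) T (\<lambda>p. u p \<otimes>\<^bsub>X\<^esub> v p)"
      if "continuous_map (prod_topology T T) T u" "continuous_map (prod_topology T T) T v" for u v
      using continuous_map_compose [OF continuous_map_pairedI [OF that] X.continuous_mult]
      by (simp add: o_def)
    have **: "continuous_map (prod_topology T T) T (\<lambda>p. inv\<^bsub>X\<^esub> (u p))"
      if "continuous_map (prod_topology T T) T u" for u
      using continuous_map_compose [OF that X.continuous_inv] by (simp add: o_def)
    show "continuous_map (prod_topology T T) T (\<lambda>p. fst p \<otimes>\<^bsub>X\<^esub> inv\<^bsub>X\<^esub> (snd p))"
      "continuous_map (prod_topology T T) T (\<lambda>p. inv\<^bsub>X\<^esub> (fst p) \<otimes>\<^bsub>X\<^esub> snd p)"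
      by (intro * ** continuous_map_fst continuous_map_snd)+
  qed
  then have cont: "continuous_map (prod_topology T T) T (\<lambda>(a, u). a \<otimes>\<^bsub>X\<^esub> inv\<^bsub>X\<^esub> u)"
    "continuous_map (prod_topology T T) T (\<lambda>(a, u). inv\<^bsub>X\<^esub> a \<otimes>\<^bsub>X\<^esub> u)"
    by (simp_all add: case_prod_unfold)
  \<comment> \<open>To be used with \<open>a\<close> = \<open>\<phi> g y\<close>, turning closeness
    of \<open>w\<close> and \<open>w'\<close> under \<open>g\<close> into closeness of
    \<open>x\<close> and \<open>z\<close> under \<open>g\<close>.\<close>
  obtain \<eta> where "\<eta> > 0" and \<eta>: "\<And>a u v. \<lbrakk>a \<in> carrier X; u \<in> carrier X; v \<in> carrier X;
      d u v < \<eta>\<rbrakk> \<Longrightarrow> d (a \<otimes>\<^bsub>X\<^esub> inv\<^bsub>X\<^esub> u) (a \<otimes>\<^bsub>X\<^esub> inv\<^bsub>X\<^esub> v) < \<epsilon>"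
    using compact_imp_uniformly_equicontinuous [OF X.compact assms(6) cont(1) \<open>\<epsilon> > 0\<close>]
    by (metis X.topspace_eq)
  \<comment> \<open>Two points within \<open>\<eta> / 3\<close> of the identity are at distance at
    most \<open>2 * \<eta> / 3\<close>, strictly below \<open>\<eta>\<close>.\<close>
  have "\<eta> / 3 > 0"
    using \<open>\<eta> > 0\<close> by simp
  \<comment> \<open>To be used with \<open>a\<close> = \<open>u\<close> = \<open>\<phi> g x\<close>
    and \<open>v\<close> = \<open>\<phi> g y\<close>: the first product is then the identity and the
    second is \<open>\<phi> g\<close> applied to the quotient of \<open>x\<close> and
    \<open>y\<close>.\<close>
  obtain \<delta> where "\<delta> > 0" and \<delta>: "\<And>a u v. \<lbrakk>a \<in> carrier X; u \<in> carrier X; v \<in> carrier X;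
      d u v < \<delta>\<rbrakk> \<Longrightarrow> d (inv\<^bsub>X\<^esub> a \<otimes>\<^bsub>X\<^esub> u) (inv\<^bsub>X\<^esub> a \<otimes>\<^bsub>X\<^esub> v) < \<eta> / 3"
    using compact_imp_uniformly_equicontinuous [OF X.compact assms(6) cont(2) \<open>\<eta> / 3 > 0\<close>]
    by (metis X.topspace_eq)
  \<comment> \<open>Closed balls make every \<open>C g\<close> a closed set, as the compactness
    lemma requires.\<close>
  define C where "C g = {w \<in> topspace T. \<phi> g w \<in> M.mcball \<one>\<^bsub>X\<^esub> (\<eta> / 3)}" for g
  have C_iff: "w \<in> C g \<longleftrightarrow> w \<in> carrier X \<and> d \<one>\<^bsub>X\<^esub> (\<phi> g w) \<le> \<eta> / 3"
    if "g \<in> carrier G" for g w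
    unfolding C_def M.in_mcball using that by auto
  have closed: "closedin T (C g)" if "g \<in> carrier G" for g
    unfolding C_def
    by (rule closedin_continuous_map_preimage [OF act.continuous_act [OF that]])
      (use M.closedin_mcball T in simp)
  \<comment> \<open>Halving \<open>\<delta>\<close> turns the non-strict bound in
    \<open>memory_set\<close> into the strict one that the modulus asks for. Both
    \<open>\<eta>\<close> and \<open>\<delta>\<close> are fixed before \<open>A\<close>
    appears.\<close>
  have "\<exists>B. memory_set (carrier G) (carrier X) d \<phi> \<epsilon> (\<delta> / 2) A B"
    if A: "finite A \<and> A \<subseteq> carrier G" for A
  proof -
    have "\<exists>F. finite F \<and> F \<subseteq> carrier G - A \<and> (\<forall>w\<in>topspace T. (\<forall>g\<in>F. w \<in> C g) \<longrightarrow>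
        (\<exists>w'\<in>topspace T. (\<forall>g\<in>carrier G - A. w' \<in> C g) \<and> (\<forall>g\<in>A. d (\<phi> g w) (\<phi> g w') < \<eta>)))"
      using A closed act.continuous_act \<open>\<eta> > 0\<close>
      by (intro compact_space_finite_Inter_approx [OF X.compact assms(6)]) blast+
    then obtain F where "finite F" and F: "F \<subseteq> carrier G - A"
      and ex: "\<forall>w\<in>topspace T. (\<forall>g\<in>F. w \<in> C g) \<longrightarrow>
        (\<exists>w'\<in>topspace T. (\<forall>g\<in>carrier G - A. w' \<in> C g) \<and> (\<forall>g\<in>A. d (\<phi> g w) (\<phi> g w') < \<eta>))"
      by blast
    \<comment> \<open>The memory set will be \<open>A \<union> F\<close>. As \<open>F\<close> avoids
      \<open>A\<close>, the hypothesis on \<open>x\<close> and \<open>y\<close> concerns exactly the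
      elements of \<open>F\<close>.\<close>
    have "\<exists>z\<in>carrier X. (\<forall>g\<in>A \<union> F. d (\<phi> g x) (\<phi> g z) \<le> \<epsilon>) \<and>
        (\<forall>g\<in>carrier G - A. d (\<phi> g y) (\<phi> g z) \<le> \<epsilon>)"
      if x: "x \<in> carrier X" and y: "y \<in> carrier X"
        and xy: "\<forall>g\<in>F. d (\<phi> g x) (\<phi> g y) \<le> \<delta> / 2" for x y
    proof -
      define w where "w = inv\<^bsub>X\<^esub> x \<otimes>\<^bsub>X\<^esub> y"
      have w: "w \<in> carrier X" and x_eq: "x = y \<otimes>\<^bsub>X\<^esub> inv\<^bsub>X\<^esub> w"
        using x y by (simp_all add: w_def X.inv_mult_group X.m_assoc [symmetric])
      have wC: "w \<in> C g" if "g \<in> F" for g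
      proof -
        have g: "g \<in> carrier G"
          using that F by auto
        have "d (\<phi> g x) (\<phi> g y) < \<delta>"
          using xy that \<open>\<delta> > 0\<close> by fastforce
        from \<delta> [OF _ _ _ this, of "\<phi> g x"] show ?thesis
          using g x y w by (simp add: C_iff w_def)
      qed
      obtain w' where w': "w' \<in> carrier X" and w'C: "\<And>g. g \<in> carrier G - A \<Longrightarrow> w' \<in> C g"
        and w'A: "\<And>g. g \<in> A \<Longrightarrow> d (\<phi> g w) (\<phi> g w') < \<eta>"
        using ex [rule_format, of w] w wC by auto
      define z where "z = y \<otimes>\<^bsub>X\<^esub> inv\<^bsub>X\<^esub> w'"
      have z: "z \<in> carrier X"
        using y w' by (simp add: z_def)
      have "d (\<phi> g x) (\<phi> g z) < \<epsilon>" if "g \<in> A \<union> F" for g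
      proof -
        have g: "g \<in> carrier G"
          using that F A by auto
        \<comment> \<open>On \<open>A\<close> this is the choice of \<open>w'\<close>. On
          \<open>F\<close> both images are near the identity: that of \<open>w\<close> by the
          hypothesis on \<open>x\<close> and \<open>y\<close>, that of \<open>w'\<close> because
          \<open>F\<close> lies outside \<open>A\<close>.\<close>
        have "d (\<phi> g w) (\<phi> g w') < \<eta>"
        proof (cases "g \<in> A")
          case False
          then have "d \<one>\<^bsub>X\<^esub> (\<phi> g w) \<le> \<eta> / 3" "d \<one>\<^bsub>X\<^esub> (\<phi> g w') \<le> \<eta> / 3"
            using that wC [of g] w'C [of g] g by (auto simp: C_iff)
          then show ?thesis
            using M.triangle [of "\<phi> g w" "\<one>\<^bsub>X\<^esub>" "\<phi> g w'"] M.commute [of "\<phi> g w" "\<one>\<^bsub>X\<^esub>"]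
              g w w' \<open>\<eta> > 0\<close> by simp
        qed (use w'A in auto)
        then have "d (\<phi> g y \<otimes>\<^bsub>X\<^esub> inv\<^bsub>X\<^esub> (\<phi> g w)) (\<phi> g y \<otimes>\<^bsub>X\<^esub> inv\<^bsub>X\<^esub> (\<phi> g w')) < \<epsilon>"
          using g y w w' by (intro \<eta>) auto
        moreover have "\<phi> g x = \<phi> g y \<otimes>\<^bsub>X\<^esub> inv\<^bsub>X\<^esub> (\<phi> g w)"
          by (subst x_eq) (use g y w in simp)
        ultimately show ?thesis
          using g y w' by (simp add: z_def)
      qed
      moreover have "d (\<phi> g y) (\<phi> g z) < \<epsilon>" if "g \<in> carrier G - A" for g
      proof -
        \<comment> \<open>Outside \<open>A\<close> the point \<open>w'\<close> is compared with the
          identity instead of \<open>w\<close>, since dividing \<open>y\<close> by the identity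
          returns \<open>y\<close>.\<close>
        have "d \<one>\<^bsub>X\<^esub> (\<phi> g w') < \<eta>"
          using w'C [OF that] that \<open>\<eta> > 0\<close> by (auto simp: C_iff)
        then have "d (\<phi> g y \<otimes>\<^bsub>X\<^esub> inv\<^bsub>X\<^esub> \<one>\<^bsub>X\<^esub>) (\<phi> g y \<otimes>\<^bsub>X\<^esub> inv\<^bsub>X\<^esub> (\<phi> g w')) < \<epsilon>"
          using that y w' by (intro \<eta>) auto
        then show ?thesis
          using that y w' by (simp add: z_def)
      qed
      ultimately show ?thesis
        using z by (meson less_imp_le)
    qed
    moreover have "A \<union> F - A = F"
      using F by auto
    ultimately have "memory_set (carrier G) (carrier X) d \<phi> \<epsilon> (\<delta> / 2) A (A \<union> F)"
      using A F \<open>finite F\<close> \<open>\<epsilon> > 0\<close> \<open>\<delta> > 0\<close> by (auto simp: memory_set_def orbit_dist_le_iff)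
    then show ?thesis ..
  qed
  then show "\<exists>\<delta>>0. \<forall>A. finite A \<and> A \<subseteq> carrier G \<longrightarrow>
      (\<exists>B. memory_set (carrier G) (carrier X) d \<phi> \<epsilon> \<delta> A B)"
    using \<open>\<delta> > 0\<close> by (meson half_gt_zero)
qed

end
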